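(* Let $\alpha\in(0,1]$ and assume that there exists a constant $C\in(0,\infty)$ such that a.s. for all $t\in[0,T]$ the first-order spatial derivatives of $\mu_t$ and $\sigma_t$ exist and, for all multiindices $|\gamma|=1$ and all $x,y\in\mathbb{R}^d$, $$|\partial_\gamma\mu_t(x)-\partial_\gamma\mu_t(y)|+\|\partial_\gamma\sigma_t(x)-\partial_\gamma\sigma_t(y)\|_{\ell^2(\mathbb{R}^d)}\le C|x-y|^\alpha,$$ $$|\partial_\gamma\mu_t(x)|+\|\partial_\gamma\sigma_t(x)\|_{\ell^2(\mathbb{R}^d)}\le C,\qquad|\mu_t(x)|+\|\sigma_t(x)\|_{\ell^2(\mathbb{R}^d)}\le C(1+|x|).$$ Then, $\mathbb{P}$-a.s., the inverse flow $$\Psi\colon\{(t,s):0\le s\le t\le T\}\times\mathbb{R}^d\to\mathbb{R}^d,\qquad(t,s,y)\mapsto\Psi_{t,s}(y):=\xi_{s,t}^{-1}(y)$$ lies in $C^{\alpha/2-,1}_{\mathrm{loc}}\big(\{(t,s):0\le s\le t\le T\}\times\mathbb{R}^d;\mathbb{R}^d\big)$.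
   Context: $d\in\mathbb{N}$, $T\in(0,\infty)$; $(\Omega,\mathcal{A},\mathbb{P})$ is a probability space with complete filtration $\mathscr{F}=(\mathscr{F}_t)_{t\ge0}$; $(w^n)_{n\ge1}$ are independent $\mathscr{F}$-Brownian motions; $\mathcal{P}$ is the progressive $\sigma$-algebra. The coefficients $\mu\colon[0,\infty)\times\Omega\times\mathbb{R}^d\to\mathbb{R}^d$ and $\sigma=(\sigma_n)_{n\ge1}\colon[0,\infty)\times\Omega\times\mathbb{R}^d\to\ell^2(\mathbb{R}^d)$ are $\mathcal{P}\otimes\mathcal{B}(\mathbb{R}^d)$-measurable. The stochastic flow $\xi_{s,t}(x)$, $0\le s\le t\le T$, solves $$\mathrm{d}\xi_{s,t}(x)=\mu_t(\xi_{s,t}(x))\,\mathrm{d}t+\sum_{n\ge1}\sigma_{n,t}(\xi_{s,t}(x))\,\mathrm{d}w^n_t,\quad t\in[s,T],\qquad\xi_{s,s}(x)=x,$$ and $\xi$ always denotes the modification that is a.s. continuous in $(s,t,x)$ (unique up to null sets), for which a.s. every $\xi_{s,t}\colon\mathbb{R}^d\to\mathbb{R}^d$ is a $C^1$-diffeomorphism, the flow property $\xi_{r,t}=\xi_{s,t}\circ\xi_{r,s}$ ($r\le s\le t$) holds, and $\xi$ lies in $C^{\alpha/2-,(1+\alpha)-}_{\mathrm{loc}}$; such a modification exists (Kunita). $\Psi\in C^{\alpha/2-,1}_{\mathrm{loc}}$ means: for every $\beta\in(0,\alpha)$ and every bounded $V\subset\mathbb{R}^d$ there is a (random) constant $K<\infty$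 with $|\Psi_{t,s}(y)-\Psi_{t',s'}(y')|\le K\big(|(t,s)-(t',s')|^{\beta/2}+|y-y'|\big)$ for all admissible $(t,s),(t',s')$ and $y,y'\in V$. *)

theory Defs
  imports "HOL-Probability.Probability"
begin

typedef (overloaded) 'a l2 = "{f :: nat \<Rightarrow> 'a::real_normed_vector. summable (\<lambda>n. (norm (f n))\<^sup>2)}"
  morphisms l2_nth Abs_l2
  by (rule exI[of _ "\<lambda>_. 0"]) simp

setup_lifting type_definition_l2

lemma l2_partial_sum_le:
  fixes f g :: "nat \<Rightarrow> 'a::real_normed_vector"
  assumes "summable (\<lambda>n. (norm (f n))\<^sup>2)" "summable (\<lambda>n. (norm (g n))\<^sup>2)"
  shows "(\<Sum>n<N. (norm (f n + g n))\<^sup>2)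
         \<le> (sqrt (\<Sum>n. (norm (f n))\<^sup>2) + sqrt (\<Sum>n. (norm (g n))\<^sup>2))\<^sup>2"
proof -
  have le: "L2_set (\<lambda>n. norm (h n)) {..<N} \<le> sqrt (\<Sum>n. (norm (h n))\<^sup>2)"
    if "summable (\<lambda>n. (norm (h n))\<^sup>2)" for h :: "nat \<Rightarrow> 'a"
    unfolding L2_set_def using that by (auto intro!: sum_le_suminf)
  have "L2_set (\<lambda>n. norm (f n + g n)) {..<N} \<le> L2_set (\<lambda>n. norm (f n) + norm (g n)) {..<N}"
    by (intro L2_set_mono) (auto intro: norm_triangle_ineq)
  also have "\<dots> \<le> L2_set (\<lambda>n. norm (f n)) {..<N} + L2_set (\<lambda>n. norm (g n)) {..<N}"
    by (rule L2_set_triangle_ineq)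
  also have "\<dots> \<le> sqrt (\<Sum>n. (norm (f n))\<^sup>2) + sqrt (\<Sum>n. (norm (g n))\<^sup>2)"
    by (intro add_mono le assms)
  finally have "(L2_set (\<lambda>n. norm (f n + g n)) {..<N})\<^sup>2
      \<le> (sqrt (\<Sum>n. (norm (f n))\<^sup>2) + sqrt (\<Sum>n. (norm (g n))\<^sup>2))\<^sup>2"
    by (intro power_mono) auto
  then show ?thesis
    by (simp add: L2_set_def sum_nonneg)
qed

lemma l2_add_summable:
  fixes f g :: "nat \<Rightarrow> 'a::real_normed_vector"
  assumes "summable (\<lambda>n. (norm (f n))\<^sup>2)" "summable (\<lambda>n. (norm (g n))\<^sup>2)"
  shows "summable (\<lambda>n. (norm (f n + g n))\<^sup>2)"
  by (rule summableI_nonneg_bounded[OF _ l2_partial_sum_le[OF assms]]) simp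

lemma l2_triangle:
  fixes f g :: "nat \<Rightarrow> 'a::real_normed_vector"
  assumes "summable (\<lambda>n. (norm (f n))\<^sup>2)" "summable (\<lambda>n. (norm (g n))\<^sup>2)"
  shows "sqrt (\<Sum>n. (norm (f n + g n))\<^sup>2)
         \<le> sqrt (\<Sum>n. (norm (f n))\<^sup>2) + sqrt (\<Sum>n. (norm (g n))\<^sup>2)"
proof (rule real_le_lsqrt)
  show "0 \<le> sqrt (\<Sum>n. (norm (f n))\<^sup>2) + sqrt (\<Sum>n. (norm (g n))\<^sup>2)"
    by (simp add: assms suminf_nonneg)
  show "(\<Sum>n. (norm (f n + g n))\<^sup>2)
      \<le> (sqrt (\<Sum>n. (norm (f n))\<^sup>2) + sqrt (\<Sum>n. (norm (g n))\<^sup>2))\<^sup>2"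
    by (intro suminf_le_const l2_add_summable l2_partial_sum_le assms)
qed

instantiation l2 :: (real_normed_vector) real_normed_vector
begin

lift_definition zero_l2 :: "'a l2" is "\<lambda>_. 0" by simp

lift_definition plus_l2 :: "'a l2 \<Rightarrow> 'a l2 \<Rightarrow> 'a l2" is "\<lambda>f g n. f n + g n"
  by (rule l2_add_summable)

lift_definition uminus_l2 :: "'a l2 \<Rightarrow> 'a l2" is "\<lambda>f n. - f n" by simp

lift_definition minus_l2 :: "'a l2 \<Rightarrow> 'a l2 \<Rightarrow> 'a l2" is "\<lambda>f g n. f n - g n"
  subgoal for f g using l2_add_summable[of f "\<lambda>n. - g n"] by simp
  done

lift_definition scaleR_l2 :: "real \<Rightarrow> 'a l2 \<Rightarrow> 'a l2" is "\<lambda>c f n. c *\<^sub>R f n"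
  by (simp add: power_mult_distrib)

lift_definition norm_l2 :: "'a l2 \<Rightarrow> real" is "\<lambda>f. sqrt (\<Sum>n. (norm (f n))\<^sup>2)" .

definition sgn_l2 :: "'a l2 \<Rightarrow> 'a l2" where
  "sgn_l2 f = inverse (norm f) *\<^sub>R f"

definition dist_l2 :: "'a l2 \<Rightarrow> 'a l2 \<Rightarrow> real" where
  "dist_l2 f g = norm (f - g)"

definition uniformity_l2 :: "('a l2 \<times> 'a l2) filter" where
  "uniformity_l2 = (INF e\<in>{0<..}. principal {(f, g). dist f g < e})"

definition open_l2 :: "'a l2 set \<Rightarrow> bool" where
  "open_l2 U \<longleftrightarrow> (\<forall>f\<in>U. eventually (\<lambda>(f', g). f' = f \<longrightarrow> g \<in> U) uniformity)"

instance
proof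
  fix f g h :: "'a l2" and c d :: real
  show "f + g + h = f + (g + h)" by transfer (simp add: add.assoc)
  show "f + g = g + f" by transfer (simp add: add.commute)
  show "0 + f = f" by transfer simp
  show "- f + f = 0" by transfer simp
  show "f - g = f + - g" by transfer simp
  show "c *\<^sub>R (f + g) = c *\<^sub>R f + c *\<^sub>R g" by transfer (simp add: scaleR_add_right)
  show "(c + d) *\<^sub>R f = c *\<^sub>R f + d *\<^sub>R f" by transfer (simp add: scaleR_add_left)
  show "c *\<^sub>R d *\<^sub>R f = (c * d) *\<^sub>R f" by transfer simp
  show "1 *\<^sub>R f = f" by transfer simp
  show "dist f g = norm (f - g)" by (rule dist_l2_def)
  show "sgn f = inverse (norm f) *\<^sub>R f" by (rule sgn_l2_def)
  show "(uniformity :: ('a l2 \<times> 'a l2) filter)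
      = (INF e\<in>{0<..}. principal {(f, g). dist f g < e})"
    by (rule uniformity_l2_def)
  show "open U \<longleftrightarrow> (\<forall>f\<in>U. eventually (\<lambda>(f', g). f' = f \<longrightarrow> g \<in> U) uniformity)"
    for U :: "'a l2 set"
    by (rule open_l2_def)
  show "norm f = 0 \<longleftrightarrow> f = 0"
    by transfer (auto simp: suminf_eq_zero_iff fun_eq_iff)
  show "norm (f + g) \<le> norm f + norm g" by transfer (rule l2_triangle)
  show "norm (c *\<^sub>R f) = \<bar>c\<bar> * norm f"
  proof transfer
    fix c :: real and f :: "nat \<Rightarrow> 'a"
    assume "summable (\<lambda>n. (norm (f n))\<^sup>2)"
    from suminf_mult[OF this, of "c\<^sup>2"]
    show "sqrt (\<Sum>n. (norm (c *\<^sub>R f n))\<^sup>2) = \<bar>c\<bar> * sqrt (\<Sum>n. (norm (f n))\<^sup>2)"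
      by (simp add: power_mult_distrib real_sqrt_mult)
  qed
qed

end

text \<open>The time set is \<open>{0..}\<close>; the values of \<open>F\<close> at negative times play no role.\<close>

definition complete_filtration :: "'w measure \<Rightarrow> (real \<Rightarrow> 'w measure) \<Rightarrow> bool" where
  "complete_filtration M F \<longleftrightarrow>
     (\<forall>t\<ge>0. subalgebra M (F t)) \<and>
     (\<forall>s\<ge>0. \<forall>t\<ge>s. subalgebra (F t) (F s)) \<and>
     (\<forall>N\<in>null_sets M. \<forall>A\<subseteq>N. A \<in> sets (F 0))"

definition progressive :: "(real \<Rightarrow> 'w measure) \<Rightarrow> (real \<times> 'w) measure" where
  "progressive F = sigma ({0..} \<times> space (F 0))
     {A. A \<subseteq> {0..} \<times> space (F 0) \<and>
        (\<forall>t\<ge>0. A \<inter> ({0..t} \<times> space (F 0)) \<in> sets (restrict_space borel {0..t} \<Otimes>\<^sub>M F t))}"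

lemma sets_progressive:
  assumes "complete_filtration M F"
  shows "sets (progressive F) =
     {A. A \<subseteq> {0..} \<times> space (F 0) \<and>
        (\<forall>t\<ge>0. A \<inter> ({0..t} \<times> space (F 0)) \<in> sets (restrict_space borel {0..t} \<Otimes>\<^sub>M F t))}"
    (is "_ = ?S")
proof -
  let ?\<Omega> = "{0..} \<times> space (F 0)"
  have sp: "space (restrict_space borel {0..t} \<Otimes>\<^sub>M F t) = {0..t} \<times> space (F 0)" if "t \<ge> 0" for t :: real
    using assms that
    by (auto simp: complete_filtration_def subalgebra_def space_pair_measure space_restrict_space)
  have "sigma_algebra ?\<Omega> ?S"
    unfolding sigma_algebra_iff2
  proof (intro conjI ballI allI impI)
    show "?S \<subseteq> Pow ?\<Omega>" by auto
    show "{} \<in> ?S" by auto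
    fix A assume A: "A \<in> ?S"
    have "(?\<Omega> - A) \<inter> ({0..t} \<times> space (F 0)) \<in> sets (restrict_space borel {0..t} \<Otimes>\<^sub>M F t)"
      if "t \<ge> 0" for t
    proof -
      have "(?\<Omega> - A) \<inter> ({0..t} \<times> space (F 0))
          = space (restrict_space borel {0..t} \<Otimes>\<^sub>M F t) - A \<inter> ({0..t} \<times> space (F 0))"
        using sp[OF that] by auto
      then show ?thesis using A that by (metis (lifting) mem_Collect_eq sets.compl_sets)
    qed
    then show "?\<Omega> - A \<in> ?S" by auto
  next
    fix A :: "nat \<Rightarrow> _" assume A: "range A \<subseteq> ?S"
    have "(\<Union>i. A i) \<inter> ({0..t} \<times> space (F 0)) \<in> sets (restrict_space borel {0..t} \<Otimes>\<^sub>M F t)"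
      if "t \<ge> 0" for t
    proof -
      have "(\<Union>i. A i \<inter> ({0..t} \<times> space (F 0))) \<in> sets (restrict_space borel {0..t} \<Otimes>\<^sub>M F t)"
        using A that by (intro sets.countable_UN) auto
      moreover have "(\<Union>i. A i) \<inter> ({0..t} \<times> space (F 0)) = (\<Union>i. A i \<inter> ({0..t} \<times> space (F 0)))"
        by blast
      ultimately show ?thesis by (simp only:)
    qed
    then show "(\<Union>i. A i) \<in> ?S" using A by auto
  qed
  then show ?thesis
    unfolding progressive_def by (simp add: sigma_algebra.sets_measure_of_eq)
qed

definition brownian_motion ::
    "'w measure \<Rightarrow> (real \<Rightarrow> 'w measure) \<Rightarrow> (real \<Rightarrow> 'w \<Rightarrow> real) \<Rightarrow> bool" where
  "brownian_motion M F w \<longleftrightarrow>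
     (\<forall>t\<ge>0. w t \<in> borel_measurable (F t)) \<and>
     (AE \<omega> in M. w 0 \<omega> = 0) \<and>
     (AE \<omega> in M. continuous_on {0..} (\<lambda>t. w t \<omega>)) \<and>
     (\<forall>s\<ge>0. \<forall>t>s.
        distributed M lborel (\<lambda>\<omega>. w t \<omega> - w s \<omega>) (normal_density 0 (sqrt (t - s))) \<and>
        prob_space.indep_set M (sets (F s))
          {(\<lambda>\<omega>. w t \<omega> - w s \<omega>) -` B \<inter> space M | B. B \<in> sets borel})"

text \<open>The sequence \<open>(w\<^sup>n)\<close>, \<open>n \<ge> 1\<close>, is indexed by \<^typ>\<open>nat\<close> starting from \<open>0\<close>. Independence is that
  of the processes, regarded as random variables in \<open>\<real>\<^bsup>[0,\<infinity>)\<^esup>\<close> with the product \<open>\<sigma>\<close>-algebra.\<close>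

definition independent_brownian_motions ::
    "'w measure \<Rightarrow> (real \<Rightarrow> 'w measure) \<Rightarrow> (nat \<Rightarrow> real \<Rightarrow> 'w \<Rightarrow> real) \<Rightarrow> bool" where
  "independent_brownian_motions M F w \<longleftrightarrow>
     (\<forall>n. brownian_motion M F (w n)) \<and>
     prob_space.indep_vars M (\<lambda>_. Pi\<^sub>M {0..} (\<lambda>_. borel)) (\<lambda>n \<omega>. \<lambda>t\<in>{0..}. w n t \<omega>) UNIV"

definition null_in_probability :: "'w measure \<Rightarrow> (nat \<Rightarrow> 'w \<Rightarrow> ennreal) \<Rightarrow> bool" where
  "null_in_probability M X \<longleftrightarrow>
     (\<forall>k. X k \<in> borel_measurable M) \<and>
     (\<forall>\<epsilon>>0. (\<lambda>k. measure M {\<omega> \<in> space M. ennreal \<epsilon> < X k \<omega>}) \<longlonglongrightarrow> 0)"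

text \<open>Convergence in probability, uniformly on \<open>[0,T]\<close>.\<close>

definition ucp_tendsto ::
    "'w measure \<Rightarrow> real \<Rightarrow> (nat \<Rightarrow> real \<Rightarrow> 'w \<Rightarrow> 'a::real_normed_vector) \<Rightarrow> (real \<Rightarrow> 'w \<Rightarrow> 'a) \<Rightarrow> bool" where
  "ucp_tendsto M T X Y \<longleftrightarrow>
     null_in_probability M (\<lambda>k \<omega>. SUP t\<in>{0..T}. ennreal (norm (X k t \<omega> - Y t \<omega>)))"

text \<open>\<open>(m, \<tau>, Z)\<close> encodes the simple process \<open>\<Sum>i<m. Z i\<close> times the indicator of
  \<open>(\<tau> i, \<tau> (Suc i)]\<close>.\<close>

type_synonym ('w, 'a) simple = "nat \<times> (nat \<Rightarrow> real) \<times> (nat \<Rightarrow> 'w \<Rightarrow> 'a)"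

fun is_simple :: "(real \<Rightarrow> 'w measure) \<Rightarrow> ('w, 'a::real_normed_vector) simple \<Rightarrow> bool" where
  "is_simple F (m, \<tau>, Z) \<longleftrightarrow>
     0 \<le> \<tau> 0 \<and>
     (\<forall>i<m. \<tau> i \<le> \<tau> (Suc i) \<and> Z i \<in> borel_measurable (F (\<tau> i)) \<and>
        bounded (Z i ` space (F (\<tau> i))))"

fun simple_process :: "('w, 'a::real_normed_vector) simple \<Rightarrow> real \<Rightarrow> 'w \<Rightarrow> 'a" where
  "simple_process (m, \<tau>, Z) t \<omega> = (\<Sum>i<m. indicator {\<tau> i<..\<tau> (Suc i)} t *\<^sub>R Z i \<omega>)"

fun simple_integral ::
    "(real \<Rightarrow> 'w \<Rightarrow> real) \<Rightarrow> ('w, 'a::real_normed_vector) simple \<Rightarrow> real \<Rightarrow> 'w \<Rightarrow> 'a" where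
  "simple_integral w (m, \<tau>, Z) t \<omega> =
     (\<Sum>i<m. (w (min (\<tau> (Suc i)) t) \<omega> - w (min (\<tau> i) t) \<omega>) *\<^sub>R Z i \<omega>)"

text \<open>\<open>I\<^sub>t = \<integral>\<^sub>0\<^sup>t f dw\<close>, \<open>t \<in> [0,T]\<close>, for progressive \<open>f\<close> with \<open>\<integral>\<^sub>0\<^sup>T |f\<^sub>r|\<^sup>2 dr < \<infinity>\<close> almost surely;
  this determines \<open>I\<close> up to indistinguishability.\<close>

definition has_ito_integral ::
    "'w measure \<Rightarrow> (real \<Rightarrow> 'w measure) \<Rightarrow> real \<Rightarrow> (real \<Rightarrow> 'w \<Rightarrow> real) \<Rightarrow>
     (real \<Rightarrow> 'w \<Rightarrow> 'a::euclidean_space) \<Rightarrow> (real \<Rightarrow> 'w \<Rightarrow> 'a) \<Rightarrow> bool" where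
  "has_ito_integral M F T w f I \<longleftrightarrow>
     (\<lambda>(t, \<omega>). f t \<omega>) \<in> borel_measurable (progressive F) \<and>
     (AE \<omega> in M. (\<integral>\<^sup>+ t \<in> {0..T}. ennreal ((norm (f t \<omega>))\<^sup>2) \<partial>lborel) < \<infinity>) \<and>
     (\<exists>\<Phi>. (\<forall>k. is_simple F (\<Phi> k)) \<and>
        null_in_probability M
          (\<lambda>k \<omega>. \<integral>\<^sup>+ t \<in> {0..T}. ennreal ((norm (simple_process (\<Phi> k) t \<omega> - f t \<omega>))\<^sup>2) \<partial>lborel) \<and>
        ucp_tendsto M T (\<lambda>k. simple_integral w (\<Phi> k)) I)"

text \<open>\<open>X\<close> is a continuous adapted process on \<open>[s,T]\<close> with
  \<open>dX\<^sub>t = \<mu>\<^sub>t(X\<^sub>t) dt + \<Sum>n. \<sigma>\<^sub>n\<^sub>,\<^sub>t(X\<^sub>t) dw\<^sup>n\<^sub>t\<close> and \<open>X\<^sub>s = x\<close>. The integrals over \<open>[s,t]\<close> are those over \<open>[0,t]\<close>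
  of the integrand cut off before \<open>s\<close>; \<open>I n\<close> are the summands and \<open>S\<close> is the sum of the
  stochastic integrals.\<close>

definition solves_sde ::
    "'w measure \<Rightarrow> (real \<Rightarrow> 'w measure) \<Rightarrow> (nat \<Rightarrow> real \<Rightarrow> 'w \<Rightarrow> real) \<Rightarrow> real \<Rightarrow>
     (real \<Rightarrow> 'w \<Rightarrow> 'a \<Rightarrow> 'a) \<Rightarrow> (real \<Rightarrow> 'w \<Rightarrow> 'a \<Rightarrow> 'a l2) \<Rightarrow>
     real \<Rightarrow> 'a::euclidean_space \<Rightarrow> (real \<Rightarrow> 'w \<Rightarrow> 'a) \<Rightarrow> bool" where
  "solves_sde M F w T \<mu> \<sigma> s x X \<longleftrightarrow>
     (\<forall>t\<in>{s..T}. X t \<in> borel_measurable (F t)) \<and>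
     (\<forall>\<omega>\<in>space M. continuous_on {s..T} (\<lambda>t. X t \<omega>)) \<and>
     (AE \<omega> in M. X s \<omega> = x) \<and>
     (AE \<omega> in M. set_integrable lborel {s..T} (\<lambda>r. \<mu> r \<omega> (X r \<omega>))) \<and>
     (\<exists>I S.
        (\<forall>n. has_ito_integral M F T (w n)
               (\<lambda>r \<omega>. indicator {s..T} r *\<^sub>R l2_nth (\<sigma> r \<omega> (X r \<omega>)) n) (I n)) \<and>
        ucp_tendsto M T (\<lambda>N t \<omega>. \<Sum>n<N. I n t \<omega>) S \<and>
        (AE \<omega> in M. \<forall>t\<in>{s..T}.
           X t \<omega> = x + (LINT r:{s..t}|lborel. \<mu> r \<omega> (X r \<omega>)) + S t \<omega>))"

text \<open>Conditions on the coefficients at a fixed time and a fixed \<open>\<omega>\<close>. The multiindices of order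
  one are the coordinate directions; \<open>Dm\<close> and \<open>Dg\<close> are the partial derivatives, that of \<open>g\<close> being
  taken in \<open>\<ell>\<^sup>2(\<real>\<^sup>d)\<close>.\<close>

definition coefficient_bounds ::
    "real \<Rightarrow> real \<Rightarrow> (real^'d \<Rightarrow> real^'d) \<Rightarrow> (real^'d \<Rightarrow> (real^'d) l2) \<Rightarrow> bool" where
  "coefficient_bounds \<alpha> C m g \<longleftrightarrow>
     (\<exists>Dm Dg.
        (\<forall>i x. ((\<lambda>h. m (x + h *\<^sub>R axis i 1)) has_vector_derivative Dm i x) (at 0) \<and>
               ((\<lambda>h. g (x + h *\<^sub>R axis i 1)) has_vector_derivative Dg i x) (at 0)) \<and>
        (\<forall>i x y. norm (Dm i x - Dm i y) + norm (Dg i x - Dg i y) \<le> C * norm (x - y) powr \<alpha>) \<and>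
        (\<forall>i x. norm (Dm i x) + norm (Dg i x) \<le> C) \<and>
        (\<forall>x. norm (m x) + norm (g x) \<le> C * (1 + norm x)))"

text \<open>\<open>C\<^bsup>\<alpha>/2-,1\<^esup>\<^bsub>loc\<^esub>(D \<times> \<real>\<^sup>d)\<close>: time exponent \<open>\<beta>/2\<close> for every \<open>\<beta> < \<alpha>\<close>, locally Lipschitz in space.\<close>

definition holder_loc_1 ::
    "real \<Rightarrow> (real \<times> real) set \<Rightarrow> (real \<times> real \<Rightarrow> 'a::real_normed_vector \<Rightarrow> 'b::real_normed_vector) \<Rightarrow> bool" where
  "holder_loc_1 \<alpha> D \<Psi> \<longleftrightarrow>
     (\<forall>\<beta>\<in>{0<..<\<alpha>}. \<forall>V. bounded V \<longrightarrow>
        (\<exists>K. \<forall>p\<in>D. \<forall>p'\<in>D. \<forall>y\<in>V. \<forall>y'\<in>V.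
           norm (\<Psi> p y - \<Psi> p' y') \<le> K * (norm (p - p') powr (\<beta> / 2) + norm (y - y'))))"

text \<open>\<open>C\<^bsup>\<alpha>/2-,(1+\<alpha>)-\<^esup>\<^bsub>loc\<^esub>(D \<times> \<real>\<^sup>d)\<close>: in addition the spatial derivative exists and is locally
  \<open>\<beta>\<close>-Hoelder continuous in space for every \<open>\<beta> < \<alpha>\<close>, locally uniformly in the time variables.\<close>

definition holder_loc_1plus ::
    "real \<Rightarrow> (real \<times> real) set \<Rightarrow> (real \<times> real \<Rightarrow> 'a::real_normed_vector \<Rightarrow> 'b::real_normed_vector) \<Rightarrow> bool" where
  "holder_loc_1plus \<alpha> D \<Psi> \<longleftrightarrow>
     holder_loc_1 \<alpha> D \<Psi> \<and>
     (\<exists>\<Psi>' :: real \<times> real \<Rightarrow> 'a \<Rightarrow> 'a \<Rightarrow>\<^sub>L 'b.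
        (\<forall>p\<in>D. \<forall>x. (\<Psi> p has_derivative blinfun_apply (\<Psi>' p x)) (at x)) \<and>
        (\<forall>\<beta>\<in>{0<..<\<alpha>}. \<forall>V. bounded V \<longrightarrow>
           (\<exists>K. \<forall>p\<in>D. \<forall>y\<in>V. \<forall>y'\<in>V. norm (\<Psi>' p y - \<Psi>' p y') \<le> K * norm (y - y') powr \<beta>)))"

definition C1_map :: "('a::real_normed_vector \<Rightarrow> 'b::real_normed_vector) \<Rightarrow> bool" where
  "C1_map f \<longleftrightarrow>
     (\<exists>f' :: 'a \<Rightarrow> 'a \<Rightarrow>\<^sub>L 'b.
        (\<forall>x. (f has_derivative blinfun_apply (f' x)) (at x)) \<and> continuous_on UNIV f')"

definition C1_diffeo :: "('a::real_normed_vector \<Rightarrow> 'a) \<Rightarrow> bool" where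
  "C1_diffeo f \<longleftrightarrow> bij f \<and> C1_map f \<and> C1_map (inv f)"

text \<open>\<open>\<xi> s t \<omega> x\<close> is \<open>\<xi>\<^sub>s\<^sub>,\<^sub>t(x)\<close>. For fixed \<open>(s, x)\<close> it is only required to be a modification of a
  solution \<open>X\<close>, so no assumption is made on its paths outside a null set. The remaining clauses are
  the properties of the regular modification given by Kunita's theorem.\<close>

definition stochastic_flow ::
    "'w measure \<Rightarrow> (real \<Rightarrow> 'w measure) \<Rightarrow> (nat \<Rightarrow> real \<Rightarrow> 'w \<Rightarrow> real) \<Rightarrow> real \<Rightarrow> real \<Rightarrow>
     (real \<Rightarrow> 'w \<Rightarrow> 'a \<Rightarrow> 'a) \<Rightarrow> (real \<Rightarrow> 'w \<Rightarrow> 'a \<Rightarrow> 'a l2) \<Rightarrow>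
     (real \<Rightarrow> real \<Rightarrow> 'w \<Rightarrow> 'a \<Rightarrow> 'a::euclidean_space) \<Rightarrow> bool" where
  "stochastic_flow M F w T \<alpha> \<mu> \<sigma> \<xi> \<longleftrightarrow>
     (\<forall>s\<in>{0..T}. \<forall>x. \<exists>X. solves_sde M F w T \<mu> \<sigma> s x X \<and>
        (\<forall>t\<in>{s..T}. AE \<omega> in M. \<xi> s t \<omega> x = X t \<omega>)) \<and>
     (AE \<omega> in M. continuous_on ({(s, t). 0 \<le> s \<and> s \<le> t \<and> t \<le> T} \<times> UNIV)
        (\<lambda>((s, t), x). \<xi> s t \<omega> x)) \<and>
     (AE \<omega> in M. \<forall>s t. 0 \<le> s \<and> s \<le> t \<and> t \<le> T \<longrightarrow> C1_diffeo (\<xi> s t \<omega>)) \<and>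
     (AE \<omega> in M. \<forall>r s t. 0 \<le> r \<and> r \<le> s \<and> s \<le> t \<and> t \<le> T \<longrightarrow> \<xi> r t \<omega> = \<xi> s t \<omega> \<circ> \<xi> r s \<omega>) \<and>
     (AE \<omega> in M. holder_loc_1plus \<alpha> {(s, t). 0 \<le> s \<and> s \<le> t \<and> t \<le> T} (\<lambda>(s, t). \<xi> s t \<omega>))"

end

theory Submission
  imports Defs
begin

text \<open>
  The assertion holds path by path: apart from measure-theoretic bookkeeping it is a statement about
  a family of \<open>C\<^sup>1\<close>-diffeomorphisms \<open>f\<^sub>p = \<xi>\<^bsub>s,t\<^esub>\<close>, where \<open>p = (s, t)\<close> ranges over the compact triangle
  \<open>D\<close>, \<open>f\<close> is jointly continuous and locally Hoelder continuous in \<open>p\<close>, and the spatial derivatives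
  are locally Hoelder continuous in space, uniformly in \<open>p\<close>. There are two ingredients.

  The inverse \<open>(p, y) \<mapsto> f\<^sub>p\<^sup>-\<^sup>1(y)\<close> is jointly continuous (\<open>continuous_on_inv_family\<close>). Near
  \<open>(p, y)\<close> this is Brouwer's theorem: a fixed point of \<open>x \<mapsto> f\<^sub>p\<^sup>-\<^sup>1(z - f\<^sub>q(x) + f\<^sub>p(x))\<close> is a
  solution of \<open>f\<^sub>q(x) = z\<close>, and this map preserves a small ball around \<open>f\<^sub>p\<^sup>-\<^sup>1(y)\<close> once \<open>(q, z)\<close> is
  close to \<open>(p, y)\<close>. In particular \<open>f\<^sub>p\<^sup>-\<^sup>1(y)\<close> stays in a fixed ball for \<open>p \<in> D\<close> and bounded \<open>y\<close>.

  On a ball, \<open>c |x - x'| \<le> |f\<^sub>p(x) - f\<^sub>p(x')|\<close> for some \<open>c > 0\<close> independent of \<open>p \<in> D\<close>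
  (\<open>inj_family_lower_bound\<close>). Otherwise there is, by compactness, a limiting point \<open>(p, x)\<close> and a
  limiting unit vector \<open>e\<close> along which the derivative of \<open>f\<^sub>p\<close> at \<open>x\<close> vanishes, which is
  impossible as \<open>f\<^sub>p\<^sup>-\<^sup>1\<close> is differentiable.

  If now \<open>x = f\<^sub>p\<^sup>-\<^sup>1(y)\<close> and \<open>x' = f\<^sub>q\<^sup>-\<^sup>1(y')\<close>, then
  \<open>c |x - x'| \<le> |f\<^sub>p(x) - f\<^sub>p(x')| \<le> |y - y'| + |f\<^sub>q(x') - f\<^sub>p(x')|\<close>, and the last term is controlled
  by the Hoelder continuity of \<open>f\<close> in \<open>p\<close>.
\<close>

section \<open>Continuity of the inverse in a family of homeomorphisms\<close>

lemma continuous_on_inv_family: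
  fixes f :: "'p::metric_space \<Rightarrow> 'a::euclidean_space \<Rightarrow> 'a"
  assumes D: "compact D"
    and cont: "continuous_on (D \<times> UNIV) (\<lambda>(p, x). f p x)"
    and bij: "\<And>p. p \<in> D \<Longrightarrow> bij (f p)"
    and inv_cont: "\<And>p. p \<in> D \<Longrightarrow> continuous_on UNIV (inv (f p))"
  shows "continuous_on (D \<times> UNIV) (\<lambda>(p, y). inv (f p) y)"
  unfolding continuous_on_iff
proof (intro ballI allI impI, clarify)
  fix p y and \<epsilon> :: real
  assume p: "p \<in> D" and "0 < \<epsilon>"
  define \<epsilon>' where "\<epsilon>' = \<epsilon> / 2"
  have \<epsilon>': "0 < \<epsilon>'" "\<epsilon>' < \<epsilon>" using \<open>0 < \<epsilon>\<close> by (auto simp: \<epsilon>'_def)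
  let ?x0 = "inv (f p) y"
  obtain \<eta> where \<eta>: "0 < \<eta>" "\<And>z. dist z y < \<eta> \<Longrightarrow> dist (inv (f p) z) ?x0 < \<epsilon>'"
    using inv_cont[OF p] \<epsilon>'(1) unfolding continuous_on_iff by (metis UNIV_I)
  have "uniformly_continuous_on (D \<times> cball ?x0 \<epsilon>') (\<lambda>(p, x). f p x)"
    using D by (intro compact_uniformly_continuous continuous_on_subset[OF cont] compact_Times) auto
  then obtain \<delta> where \<delta>: "0 < \<delta>"
    "\<And>u v. u \<in> D \<times> cball ?x0 \<epsilon>' \<Longrightarrow> v \<in> D \<times> cball ?x0 \<epsilon>' \<Longrightarrow> dist v u < \<delta> \<Longrightarrow>
      dist (case v of (p, x) \<Rightarrow> f p x) (case u of (p, x) \<Rightarrow> f p x) < \<eta> / 2"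
    unfolding uniformly_continuous_on_def using \<eta>(1) by (metis half_gt_zero)
  have close: "dist (f q x) (f p x) < \<eta> / 2"
    if "q \<in> D" "dist q p < \<delta>" "x \<in> cball ?x0 \<epsilon>'" for q x
    using \<delta>(2)[of "(p, x)" "(q, x)"] that p by (auto simp: dist_Pair_Pair)
  have cont_f: "continuous_on S (f q)" if "q \<in> D" for q S
  proof -
    have "continuous_on S (\<lambda>x. case (q, x) of (p, x) \<Rightarrow> f p x)"
      by (rule continuous_on_compose2[OF cont]) (use that in \<open>auto intro!: continuous_intros\<close>)
    then show ?thesis by simp
  qed
  have *: "dist (inv (f q) z) ?x0 < \<epsilon>"
    if q: "q \<in> D" "dist q p < \<delta>" and z: "dist z y < \<eta> / 2" for q z
  proof -
    \<comment> \<open>Fixed points of \<open>?G\<close> solve \<open>f q x = z\<close>, and by \<open>\<eta>\<close> and \<open>\<delta>\<close> it maps the ball into itself.\<close>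
    let ?G = "\<lambda>x. inv (f p) (z - f q x + f p x)"
    have "continuous_on (cball ?x0 \<epsilon>') ?G"
      by (intro continuous_on_compose2[OF inv_cont[OF p]] continuous_intros cont_f p q) auto
    moreover have "?G x \<in> cball ?x0 \<epsilon>'" if "x \<in> cball ?x0 \<epsilon>'" for x
    proof -
      have "dist (z - f q x + f p x) y \<le> dist z y + dist (f q x) (f p x)"
        using norm_triangle_ineq4[of "z - y" "f q x - f p x"]
        by (simp add: dist_norm algebra_simps)
      also have "\<dots> < \<eta>" using close[OF q that] z by simp
      finally show ?thesis using \<eta>(2) by (force simp: dist_commute)
    qed
    ultimately obtain x where x: "x \<in> cball ?x0 \<epsilon>'" "?G x = x"
      using brouwer_ball[OF \<epsilon>'(1), of ?x0 ?G] by blast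
    have "f p (?G x) = z - f q x + f p x"
      using bij[OF p] by (simp add: bij_is_surj surj_f_inv_f)
    with x(2) have "f q x = z" by simp
    then have "inv (f q) z = x"
      using bij[OF q(1)] by (auto simp: bij_is_inj)
    with x(1) \<epsilon>'(2) show ?thesis by (simp add: dist_commute)
  qed
  show "\<exists>d>0. \<forall>x'\<in>D \<times> UNIV. dist x' (p, y) < d \<longrightarrow>
      dist (case x' of (p, y) \<Rightarrow> inv (f p) y) ?x0 < \<epsilon>"
  proof (intro exI conjI ballI impI)
    show "0 < min \<delta> (\<eta> / 2)" using \<delta>(1) \<eta>(1) by simp
    fix x' assume x': "x' \<in> D \<times> (UNIV :: 'a set)" "dist x' (p, y) < min \<delta> (\<eta> / 2)"
    obtain q z where [simp]: "x' = (q, z)" by fastforce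
    have "dist q p \<le> dist x' (p, y)" "dist z y \<le> dist x' (p, y)"
      using dist_fst_le[of x' "(p, y)"] dist_snd_le[of x' "(p, y)"] by simp_all
    then show "dist (case x' of (p, y) \<Rightarrow> inv (f p) y) ?x0 < \<epsilon>"
      using x' by (auto intro!: *)
  qed
qed

section \<open>A uniform lower Lipschitz bound\<close>

lemma holder_derivative_remainder:
  fixes g :: "'a::real_normed_vector \<Rightarrow> 'b::real_normed_vector" and g' :: "'a \<Rightarrow> 'a \<Rightarrow>\<^sub>L 'b"
  assumes deriv: "\<And>x. (g has_derivative blinfun_apply (g' x)) (at x)"
    and holder: "\<And>x y. x \<in> S \<Longrightarrow> y \<in> S \<Longrightarrow> norm (g' x - g' y) \<le> K * norm (x - y) powr \<beta>"
    and "convex S" "0 \<le> K" "0 \<le> \<beta>" "a \<in> S" "b \<in> S"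
  shows "norm (g b - g a - g' a (b - a)) \<le> norm (b - a) * (K * norm (b - a) powr \<beta>)"
proof (rule differentiable_bound_linearization
      [where S = "closed_segment a b" and f' = "\<lambda>x. blinfun_apply (g' x)" and ?x0.0 = a])
  show "a + t *\<^sub>R (b - a) \<in> closed_segment a b" if "t \<in> {0..1}" for t
    using that by (auto simp: in_segment algebra_simps intro!: exI[of _ t])
  show "(g has_derivative blinfun_apply (g' x)) (at x within closed_segment a b)" for x
    by (rule has_derivative_at_withinI[OF deriv])
  show "a \<in> closed_segment a b" by simp
  fix x assume x: "x \<in> closed_segment a b"
  then have "x \<in> S" using assms closed_segment_subset by blast
  have "norm (g' x - g' a) \<le> K * norm (x - a) powr \<beta>"
    using holder \<open>x \<in> S\<close> \<open>a \<in> S\<close> by blast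
  also have "\<dots> \<le> K * norm (b - a) powr \<beta>"
    using segment_bound1[OF x] assms by (intro mult_left_mono powr_mono2) auto
  finally show "onorm (blinfun_apply (g' x) - blinfun_apply (g' a)) \<le> K * norm (b - a) powr \<beta>"
    by (simp add: norm_blinfun.rep_eq minus_blinfun.rep_eq fun_diff_def)
qed

text \<open>
  The derivative is assumed to be Hoelder continuous on a ball of radius \<open>R + 1\<close>, so that
  increments of length at most \<open>1\<close> from points of the ball of radius \<open>R\<close> can be linearised. Continuity
  of the derivative in the parameter \<open>p\<close> is not assumed; the argument passes to the limit in
  increments of \<open>f\<close> instead of derivatives.
\<close>

lemma inj_family_lower_bound:
  fixes f :: "'p::metric_space \<Rightarrow> 'a::euclidean_space \<Rightarrow> 'b::real_normed_vector"
    and f' :: "'p \<Rightarrow> 'a \<Rightarrow> 'a \<Rightarrow>\<^sub>L 'b"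
  assumes D: "compact D"
    and cont: "continuous_on (D \<times> UNIV) (\<lambda>(p, x). f p x)"
    and inj: "\<And>p. p \<in> D \<Longrightarrow> inj (f p)"
    and deriv: "\<And>p x. p \<in> D \<Longrightarrow> (f p has_derivative blinfun_apply (f' p x)) (at x)"
    and inj_deriv: "\<And>p x v. p \<in> D \<Longrightarrow> f' p x v = 0 \<Longrightarrow> v = 0"
    and "0 < \<beta>"
    and holder: "\<And>p x y. p \<in> D \<Longrightarrow> x \<in> cball 0 (R + 1) \<Longrightarrow> y \<in> cball 0 (R + 1) \<Longrightarrow>
      norm (f' p x - f' p y) \<le> K * norm (x - y) powr \<beta>"
  shows "\<exists>c>0. \<forall>p\<in>D. \<forall>x\<in>cball 0 R. \<forall>y\<in>cball 0 R. c * norm (x - y) \<le> norm (f p x - f p y)"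
proof (rule ccontr)
  assume contra: "\<not> ?thesis"
  \<comment> \<open>The constant \<open>K\<close> may be negative, for instance if \<open>D\<close> is empty.\<close>
  define L where "L = max K 0"
  have remainder: "norm (f p (x + h *\<^sub>R e) - f p x - h *\<^sub>R f' p x e) \<le> h * (L * h powr \<beta>)"
    if "p \<in> D" "x \<in> cball 0 (R + 1)" "x + h *\<^sub>R e \<in> cball 0 (R + 1)" "norm e = 1" "0 \<le> h"
    for p x e h
  proof -
    have "norm (f' p x - f' p y) \<le> L * norm (x - y) powr \<beta>"
      if "x \<in> cball 0 (R + 1)" "y \<in> cball 0 (R + 1)" for x y
      using holder[OF \<open>p \<in> D\<close> that] mult_right_mono[of K L "norm (x - y) powr \<beta>"]
      by (simp add: L_def)
    then have "norm (f p (x + h *\<^sub>R e) - f p x - f' p x (x + h *\<^sub>R e - x))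
        \<le> norm (x + h *\<^sub>R e - x) * (L * norm (x + h *\<^sub>R e - x) powr \<beta>)"
      using that \<open>0 < \<beta>\<close>
      by (intro holder_derivative_remainder[where S = "cball 0 (R + 1)"] deriv) (auto simp: L_def)
    then show ?thesis using that(4,5) by (simp add: blinfun.scaleR_right)
  qed
  have "\<exists>p x y. p \<in> D \<and> x \<in> cball 0 R \<and> y \<in> cball 0 R \<and>
      norm (f p x - f p y) < inverse (real (Suc n)) * norm (x - y)" for n
    using contra by (metis inverse_positive_iff_positive not_less of_nat_0_less_iff zero_less_Suc)
  then obtain p x y where pxy: "\<And>n. p n \<in> D" "\<And>n. x n \<in> cball 0 R" "\<And>n. y n \<in> cball 0 R"
    "\<And>n. norm (f (p n) (x n) - f (p n) (y n)) < inverse (real (Suc n)) * norm (x n - y n)"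
    by metis
  define e where "e n = sgn (y n - x n)" for n
  have ne: "x n \<noteq> y n" for n using pxy(4)[of n] by auto
  have e: "norm (e n) = 1" "x n + norm (y n - x n) *\<^sub>R e n = y n" for n
    using ne[of n] by (auto simp: e_def norm_sgn sgn_div_norm)
  have "compact (D \<times> cball (0::'a) R \<times> cball (0::'a) R \<times> sphere (0::'a) 1)"
    using D by (intro compact_Times) auto
  then have "seq_compact (D \<times> cball (0::'a) R \<times> cball (0::'a) R \<times> sphere (0::'a) 1)"
    by (rule compact_imp_seq_compact)
  moreover have "\<forall>n. (p n, x n, y n, e n) \<in> D \<times> cball 0 R \<times> cball 0 R \<times> sphere 0 1"
    using pxy e by auto
  ultimately obtain l r where l: "l \<in> D \<times> cball 0 R \<times> cball 0 R \<times> sphere (0::'a) 1"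
    and r: "strict_mono r" and lim: "((\<lambda>n. (p n, x n, y n, e n)) \<circ> r) \<longlonglongrightarrow> l"
    by (rule seq_compactE)
  obtain p0 x0 y0 e0 where [simp]: "l = (p0, x0, y0, e0)" by (metis prod_cases4)
  have mem: "p0 \<in> D" "x0 \<in> cball 0 R" "norm e0 = 1" using l by auto
  have lims: "(\<lambda>n. p (r n)) \<longlonglongrightarrow> p0" "(\<lambda>n. x (r n)) \<longlonglongrightarrow> x0" "(\<lambda>n. y (r n)) \<longlonglongrightarrow> y0"
    "(\<lambda>n. e (r n)) \<longlonglongrightarrow> e0"
    using tendsto_fst[OF lim] tendsto_snd[OF lim] tendsto_fst[OF tendsto_snd[OF lim]]
      tendsto_fst[OF tendsto_snd[OF tendsto_snd[OF lim]]]
      tendsto_snd[OF tendsto_snd[OF tendsto_snd[OF lim]]]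
    by (auto simp: o_def)
  have lim_f: "(\<lambda>n. f (p (r n)) (z n)) \<longlonglongrightarrow> f p0 z0" if "z \<longlonglongrightarrow> z0" for z z0
    using continuous_on_tendsto_compose[OF cont tendsto_Pair[OF lims(1) that]] mem(1) pxy(1)
    by auto
  have lim_inv: "(\<lambda>n. inverse (real (Suc (r n)))) \<longlonglongrightarrow> 0"
    using LIMSEQ_subseq_LIMSEQ[OF LIMSEQ_inverse_real_of_nat r] by (simp add: o_def)
  have "norm (f p0 x0 - f p0 y0) \<le> 0 * norm (x0 - y0)"
  proof (rule LIMSEQ_le)
    show "(\<lambda>n. norm (f (p (r n)) (x (r n)) - f (p (r n)) (y (r n)))) \<longlonglongrightarrow> norm (f p0 x0 - f p0 y0)"
      by (intro tendsto_intros lim_f lims)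
    show "(\<lambda>n. inverse (real (Suc (r n))) * norm (x (r n) - y (r n))) \<longlonglongrightarrow> 0 * norm (x0 - y0)"
      by (intro tendsto_intros lim_inv lims)
  qed (use pxy(4) less_imp_le in blast)
  then have "x0 = y0" using inj[OF mem(1)] by (simp add: inj_eq)
  have lim_\<rho>: "(\<lambda>n. norm (y (r n) - x (r n)) powr \<beta>) \<longlonglongrightarrow> 0"
  proof -
    have "(\<lambda>n. norm (y (r n) - x (r n))) \<longlonglongrightarrow> 0"
      using tendsto_norm[OF tendsto_diff[OF lims(3,2)]] \<open>x0 = y0\<close> by simp
    from tendsto_powr'[OF this tendsto_const[of \<beta>]] \<open>0 < \<beta>\<close> show ?thesis by simp
  qed
  \<comment> \<open>The derivative at \<open>x n\<close> in the direction \<open>e n\<close> tends to \<open>0\<close> along \<open>r\<close>, since the increment from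
    \<open>x n\<close> to \<open>y n\<close> is small compared to \<open>y n - x n\<close>.\<close>
  have small: "norm (f' (p n) (x n) (e n)) \<le> inverse (real (Suc n)) + L * norm (y n - x n) powr \<beta>"
    for n
  proof -
    let ?\<rho> = "norm (y n - x n)"
    have "norm (f (p n) (y n) - f (p n) (x n) - ?\<rho> *\<^sub>R f' (p n) (x n) (e n)) \<le> ?\<rho> * (L * ?\<rho> powr \<beta>)"
      using remainder[of "p n" "x n" ?\<rho> "e n"] pxy(1-3)[of n] e[of n] by simp
    moreover have "norm (f (p n) (y n) - f (p n) (x n)) \<le> ?\<rho> * inverse (real (Suc n))"
      using pxy(4)[of n] by (simp add: norm_minus_commute mult.commute)
    ultimately have "norm (?\<rho> *\<^sub>R f' (p n) (x n) (e n)) \<le> ?\<rho> * (inverse (real (Suc n)) + L * ?\<rho> powr \<beta>)"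
      using norm_triangle_sub[of "?\<rho> *\<^sub>R f' (p n) (x n) (e n)" "f (p n) (y n) - f (p n) (x n)"]
      by (simp add: distrib_left norm_minus_commute)
    then show ?thesis using ne[of n] by simp
  qed
  \<comment> \<open>With \<open>h\<close> fixed, the increments over \<open>h *\<^sub>R e n\<close> converge along \<open>r\<close> by joint continuity of \<open>f\<close>,
    and they are controlled by the vanishing derivatives up to the Hoelder remainder.\<close>
  have incr: "norm (f p0 (x0 + h *\<^sub>R e0) - f p0 x0) \<le> h * (L * h powr \<beta>)" if h: "0 < h" "h \<le> 1" for h
  proof (rule LIMSEQ_le)
    show "(\<lambda>n. norm (f (p (r n)) (x (r n) + h *\<^sub>R e (r n)) - f (p (r n)) (x (r n))))
        \<longlonglongrightarrow> norm (f p0 (x0 + h *\<^sub>R e0) - f p0 x0)"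
      by (intro tendsto_intros lim_f lims)
    have "(\<lambda>n. h * (L * h powr \<beta>) + h * (inverse (real (Suc (r n))) + L * norm (y (r n) - x (r n)) powr \<beta>))
        \<longlonglongrightarrow> h * (L * h powr \<beta>) + h * (0 + L * 0)"
      by (intro tendsto_intros lim_inv lim_\<rho>)
    then show "(\<lambda>n. h * (L * h powr \<beta>) + h * (inverse (real (Suc (r n))) + L * norm (y (r n) - x (r n)) powr \<beta>))
        \<longlonglongrightarrow> h * (L * h powr \<beta>)" by simp
    have "norm (f (p n) (x n + h *\<^sub>R e n) - f (p n) (x n))
        \<le> h * (L * h powr \<beta>) + h * (inverse (real (Suc n)) + L * norm (y n - x n) powr \<beta>)" for n
    proof -
      have "norm (x n + h *\<^sub>R e n) \<le> R + 1"
        using norm_triangle_ineq[of "x n" "h *\<^sub>R e n"] pxy(2)[of n] e(1)[of n] h by simp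
      then have "norm (f (p n) (x n + h *\<^sub>R e n) - f (p n) (x n) - h *\<^sub>R f' (p n) (x n) (e n))
          \<le> h * (L * h powr \<beta>)"
        using remainder[of "p n" "x n" h "e n"] pxy(1,2)[of n] e(1)[of n] h by simp
      moreover have "norm (h *\<^sub>R f' (p n) (x n) (e n))
          \<le> h * (inverse (real (Suc n)) + L * norm (y n - x n) powr \<beta>)"
        using small[of n] h by simp
      ultimately show ?thesis
        using norm_triangle_sub[of "f (p n) (x n + h *\<^sub>R e n) - f (p n) (x n)" "h *\<^sub>R f' (p n) (x n) (e n)"]
        by linarith
    qed
    then show "\<exists>N. \<forall>n\<ge>N. norm (f (p (r n)) (x (r n) + h *\<^sub>R e (r n)) - f (p (r n)) (x (r n)))
        \<le> h * (L * h powr \<beta>) + h * (inverse (real (Suc (r n))) + L * norm (y (r n) - x (r n)) powr \<beta>)"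
      by blast
  qed
  \<comment> \<open>Linearising at the limit point and letting \<open>h\<close> tend to \<open>0\<close> shows \<open>f' p0 x0 e0 = 0\<close>.\<close>
  have bound: "norm (f' p0 x0 e0) \<le> 2 * L * h powr \<beta>" if h: "0 < h" "h \<le> 1" for h
  proof -
    have "norm (x0 + h *\<^sub>R e0) \<le> R + 1"
      using norm_triangle_ineq[of x0 "h *\<^sub>R e0"] mem h by simp
    then have "norm (f p0 (x0 + h *\<^sub>R e0) - f p0 x0 - h *\<^sub>R f' p0 x0 e0) \<le> h * (L * h powr \<beta>)"
      using remainder[of p0 x0 h e0] mem h by simp
    then have "norm (h *\<^sub>R f' p0 x0 e0) \<le> h * (2 * L * h powr \<beta>)"
      using incr[OF h]
        norm_triangle_sub[of "h *\<^sub>R f' p0 x0 e0" "f p0 (x0 + h *\<^sub>R e0) - f p0 x0"]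
      by (simp add: norm_minus_commute)
    then show ?thesis using h by simp
  qed
  have "norm (f' p0 x0 e0) \<le> 2 * L * 0"
  proof (rule LIMSEQ_le_const)
    have "(\<lambda>n. inverse (real (Suc n)) powr \<beta>) \<longlonglongrightarrow> 0"
      using tendsto_powr'[OF LIMSEQ_inverse_real_of_nat tendsto_const[of \<beta>]] \<open>0 < \<beta>\<close> by simp
    then show "(\<lambda>n. 2 * L * inverse (real (Suc n)) powr \<beta>) \<longlonglongrightarrow> 2 * L * 0"
      by (intro tendsto_intros)
    have "norm (f' p0 x0 e0) \<le> 2 * L * inverse (real (Suc n)) powr \<beta>" for n
      by (rule bound) (auto simp: field_simps)
    then show "\<exists>N. \<forall>n\<ge>N. norm (f' p0 x0 e0) \<le> 2 * L * inverse (real (Suc n)) powr \<beta>" by blast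
  qed
  then have "e0 = 0" using inj_deriv[OF mem(1)] by simp
  then show False using mem(3) by simp
qed

section \<open>Regularity of the inverse family\<close>

lemma C1_diffeo_derivative_eq_0:
  assumes "C1_diffeo f" and f': "(f has_derivative f') (at x)" and "f' v = 0"
  shows "v = 0"
proof -
  obtain g' where "(inv f has_derivative g') (at (f x))"
    using assms(1) unfolding C1_diffeo_def C1_map_def by blast
  from diff_chain_at[OF f' this] have "(inv f \<circ> f has_derivative g' \<circ> f') (at x)" .
  moreover have "inv f \<circ> f = (\<lambda>x. x)"
    using assms(1) by (auto simp: C1_diffeo_def bij_is_inj)
  ultimately have "(g' \<circ> f') = (\<lambda>v. v)"
    using has_derivative_unique[OF _ has_derivative_ident] by metis
  moreover have "g' 0 = 0"
    using \<open>(inv f has_derivative g') (at (f x))\<close>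
    by (simp add: has_derivative_linear linear_0)
  ultimately show ?thesis using \<open>f' v = 0\<close> by (metis comp_apply)
qed

lemma C1_diffeo_continuous_inv: "C1_diffeo f \<Longrightarrow> continuous_on UNIV (inv f)"
  unfolding C1_diffeo_def C1_map_def
  by (meson continuous_at_imp_continuous_on has_derivative_continuous)

text \<open>
  The space regularity of the inverse and its time regularity come out of one estimate: the time
  exponent of the inverse is that of \<open>f\<close>, and the Lipschitz constant is governed by the lower bound.
\<close>

proposition holder_loc_1_inv:
  fixes f :: "real \<times> real \<Rightarrow> 'a::euclidean_space \<Rightarrow> 'a"
  assumes D: "compact D"
    and cont: "continuous_on (D \<times> UNIV) (\<lambda>(p, x). f p x)"
    and diffeo: "\<And>p. p \<in> D \<Longrightarrow> C1_diffeo (f p)"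
    and holder: "holder_loc_1plus \<alpha> D f"
  shows "holder_loc_1 \<alpha> D (\<lambda>p. inv (f p))"
  unfolding holder_loc_1_def
proof (intro ballI allI impI)
  fix \<beta> and V :: "'a set"
  assume \<beta>: "\<beta> \<in> {0<..<\<alpha>}" and V: "bounded V"
  have bij: "bij (f p)" if "p \<in> D" for p using diffeo[OF that] by (simp add: C1_diffeo_def)
  have "compact ((\<lambda>(p, y). inv (f p) y) ` (D \<times> closure V))"
  proof (rule compact_continuous_image)
    show "continuous_on (D \<times> closure V) (\<lambda>(p, y). inv (f p) y)"
      using continuous_on_inv_family[OF D cont bij C1_diffeo_continuous_inv[OF diffeo]]
      by (rule continuous_on_subset) auto
    show "compact (D \<times> closure V)"
      using D V by (simp add: compact_Times compact_closure)
  qed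
  from compact_imp_bounded[OF this] obtain R
    where R: "\<forall>u\<in>(\<lambda>(p, y). inv (f p) y) ` (D \<times> closure V). norm u \<le> R"
    unfolding bounded_iff ..
  have inv_R: "inv (f p) y \<in> cball 0 R" if "p \<in> D" "y \<in> V" for p y
  proof -
    have "inv (f p) y \<in> (\<lambda>(p, y). inv (f p) y) ` (D \<times> closure V)"
      using that closure_subset[of V] by (intro image_eqI[of _ _ "(p, y)"]) auto
    from bspec[OF R this] show ?thesis by simp
  qed
  obtain f' :: "real \<times> real \<Rightarrow> 'a \<Rightarrow> 'a \<Rightarrow>\<^sub>L 'a"
    where "\<forall>p\<in>D. \<forall>x. (f p has_derivative blinfun_apply (f' p x)) (at x)"
      and f'_holder: "\<forall>\<beta>\<in>{0<..<\<alpha>}. \<forall>V. bounded V \<longrightarrow>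
        (\<exists>K. \<forall>p\<in>D. \<forall>y\<in>V. \<forall>y'\<in>V. norm (f' p y - f' p y') \<le> K * norm (y - y') powr \<beta>)"
    using holder unfolding holder_loc_1plus_def by (elim conjE exE)
  then have f': "(f p has_derivative blinfun_apply (f' p x)) (at x)" if "p \<in> D" for p x
    using that by blast
  obtain K' where K': "\<And>p x y. p \<in> D \<Longrightarrow> x \<in> cball 0 (R + 1) \<Longrightarrow> y \<in> cball 0 (R + 1) \<Longrightarrow>
      norm (f' p x - f' p y) \<le> K' * norm (x - y) powr \<beta>"
    using f'_holder[rule_format, OF \<beta> bounded_cball] by blast
  obtain c where c: "0 < c" "\<And>p x y. p \<in> D \<Longrightarrow> x \<in> cball 0 R \<Longrightarrow> y \<in> cball 0 R \<Longrightarrow>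
      c * norm (x - y) \<le> norm (f p x - f p y)"
  proof -
    have "\<exists>c>0. \<forall>p\<in>D. \<forall>x\<in>cball 0 R. \<forall>y\<in>cball 0 R. c * norm (x - y) \<le> norm (f p x - f p y)"
    proof (rule inj_family_lower_bound[OF D cont _ f' _ _ K'])
      show "0 < \<beta>" using \<beta> by simp
      show "inj (f p)" if "p \<in> D" for p using bij[OF that] by (rule bij_is_inj)
      show "v = 0" if "p \<in> D" "f' p x v = 0" for p x v
        using C1_diffeo_derivative_eq_0[OF diffeo f'] that by blast
    qed
    then show thesis using that by blast
  qed
  obtain K where K: "\<And>p q x y. p \<in> D \<Longrightarrow> q \<in> D \<Longrightarrow> x \<in> cball 0 R \<Longrightarrow> y \<in> cball 0 R \<Longrightarrow>
      norm (f p x - f q y) \<le> K * (norm (p - q) powr (\<beta> / 2) + norm (x - y))"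
  proof -
    have "\<exists>K. \<forall>p\<in>D. \<forall>q\<in>D. \<forall>x\<in>cball 0 R. \<forall>y\<in>cball 0 R.
        norm (f p x - f q y) \<le> K * (norm (p - q) powr (\<beta> / 2) + norm (x - y))"
      using holder \<beta> bounded_cball[of "0::'a" R]
      unfolding holder_loc_1plus_def holder_loc_1_def by blast
    then show thesis using that by blast
  qed
  let ?C = "max 1 K / c"
  have "norm (inv (f p) y - inv (f q) y') \<le> ?C * (norm (p - q) powr (\<beta> / 2) + norm (y - y'))"
    if "p \<in> D" "q \<in> D" "y \<in> V" "y' \<in> V" for p q y y'
  proof -
    let ?x = "inv (f p) y" and ?x' = "inv (f q) y'" and ?\<tau> = "norm (p - q) powr (\<beta> / 2)"
    have x: "f p ?x = y" "f q ?x' = y'"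
      using that bij by (simp_all add: bij_is_surj surj_f_inv_f)
    have "c * norm (?x - ?x') \<le> norm (y - f p ?x')"
      using c(2)[of p ?x ?x'] inv_R that x by simp
    also have "\<dots> \<le> norm (y - y') + norm (f p ?x' - f q ?x')"
      using norm_triangle_ineq4[of "y - y'" "f p ?x' - f q ?x'"] x by simp
    also have "norm (f p ?x' - f q ?x') \<le> K * ?\<tau>"
      using K[of p q ?x' ?x'] inv_R that by simp
    also have "norm (y - y') + K * ?\<tau> \<le> max 1 K * (?\<tau> + norm (y - y'))"
      using mult_right_mono[of K "max 1 K" ?\<tau>] mult_right_mono[of 1 "max 1 K" "norm (y - y')"]
      by (simp add: distrib_left)
    finally show ?thesis using c(1) by (simp add: field_simps)
  qed
  then show "\<exists>K. \<forall>p\<in>D. \<forall>q\<in>D. \<forall>y\<in>V. \<forall>y'\<in>V.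
      norm (inv (f p) y - inv (f q) y') \<le> K * (norm (p - q) powr (\<beta> / 2) + norm (y - y'))"
    by blast
qed

section \<open>The inverse stochastic flow\<close>

lemma compact_time_triangle: "compact {(s, t). 0 \<le> s \<and> s \<le> t \<and> t \<le> (T::real)}"
proof -
  have "{(s, t). 0 \<le> s \<and> s \<le> t \<and> t \<le> T} = ({0..T} \<times> {0..T}) \<inter> {p. fst p \<le> snd p}"
    by auto
  moreover have "closed {p :: real \<times> real. fst p \<le> snd p}"
    by (intro closed_Collect_le continuous_intros)
  ultimately show ?thesis
    by (simp add: compact_Int_closed compact_Times compact_Icc)
qed

text \<open>The inverse flow carries the two times in the opposite order to \<open>\<xi>\<close>.\<close>

lemma holder_loc_1_swap:
  assumes "holder_loc_1 \<alpha> D \<Psi>"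
  shows "holder_loc_1 \<alpha> (prod.swap ` D) (\<lambda>p. \<Psi> (prod.swap p))"
proof -
  have "norm (prod.swap p - prod.swap q) = norm (p - q)" for p q :: "real \<times> real"
    by (cases p; cases q) (simp add: norm_Pair add.commute)
  then show ?thesis
    using assms unfolding holder_loc_1_def by simp
qed

theorem proposition2p8:
  fixes M :: "'w measure"
    and F :: "real \<Rightarrow> 'w measure"
    and w :: "nat \<Rightarrow> real \<Rightarrow> 'w \<Rightarrow> real"
    and T \<alpha> :: real
    and \<mu> :: "real \<Rightarrow> 'w \<Rightarrow> real^'d \<Rightarrow> real^'d"
    and \<sigma> :: "real \<Rightarrow> 'w \<Rightarrow> real^'d \<Rightarrow> (real^'d) l2"
    and \<xi> :: "real \<Rightarrow> real \<Rightarrow> 'w \<Rightarrow> real^'d \<Rightarrow> real^'d"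
  assumes "prob_space M"
    and "complete_filtration M F"
    and "independent_brownian_motions M F w"
    and "0 < T"
    and "(\<lambda>((t, \<omega>), x). \<mu> t \<omega> x) \<in> borel_measurable (progressive F \<Otimes>\<^sub>M borel)"
    and "(\<lambda>((t, \<omega>), x). \<sigma> t \<omega> x) \<in> borel_measurable (progressive F \<Otimes>\<^sub>M borel)"
    and "0 < \<alpha>" and "\<alpha> \<le> 1"
    and "\<exists>C>0. AE \<omega> in M. \<forall>t\<in>{0..T}. coefficient_bounds \<alpha> C (\<mu> t \<omega>) (\<sigma> t \<omega>)"
    and "stochastic_flow M F w T \<alpha> \<mu> \<sigma> \<xi>"
  shows "AE \<omega> in M. holder_loc_1 \<alpha> {(t, s). 0 \<le> s \<and> s \<le> t \<and> t \<le> T}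
           (\<lambda>(t, s). inv (\<xi> s t \<omega>))"
proof -
  let ?D = "{(s, t). 0 \<le> s \<and> s \<le> t \<and> t \<le> T}"
  have "AE \<omega> in M. continuous_on (?D \<times> UNIV) (\<lambda>((s, t), x). \<xi> s t \<omega> x)"
    and "AE \<omega> in M. \<forall>s t. 0 \<le> s \<and> s \<le> t \<and> t \<le> T \<longrightarrow> C1_diffeo (\<xi> s t \<omega>)"
    and "AE \<omega> in M. holder_loc_1plus \<alpha> ?D (\<lambda>(s, t). \<xi> s t \<omega>)"
    using assms(10) unfolding stochastic_flow_def by blast+
  then show ?thesis
  proof eventually_elim
    case (elim \<omega>)
    let ?f = "\<lambda>(s, t). \<xi> s t \<omega>"
    have "holder_loc_1 \<alpha> ?D (\<lambda>p. inv (?f p))"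
      using elim compact_time_triangle
      by (intro holder_loc_1_inv) (auto simp: case_prod_beta')
    from holder_loc_1_swap[OF this]
    have "holder_loc_1 \<alpha> (prod.swap ` ?D) (\<lambda>p. inv (?f (prod.swap p)))" .
    moreover have "prod.swap ` ?D = {(t, s). 0 \<le> s \<and> s \<le> t \<and> t \<le> T}"
      by force
    moreover have "(\<lambda>p. inv (?f (prod.swap p))) = (\<lambda>(t, s). inv (\<xi> s t \<omega>))"
      by auto
    ultimately show ?case by simp
  qed
qed

end
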